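(* Let $H_{343}$ be the Heisenberg group of upper-unitriangular $3\times 3$ matrices over $\mathbb{F}_7$. Then $18\le \mathsf{d}(H_{343})\le 24$.
   Context: For $a,b,c\in\mathbb{F}_7$ write $M(a,b,c)=\begin{pmatrix}1&a&c\\0&1&b\\0&0&1\end{pmatrix}$; $H_{343}$ is the group of all such matrices under matrix multiplication, of order $343$. A sequence over a finite group $G$ is a finite unordered list of elements of $G$, with repetition allowed and the identity excluded (i.e. a finite multiset of non-identity elements). A sequence $S$ is product-one-free if no nonempty subsequence (sub-multiset) of $S$ admits an ordering of its terms whose product is the identity. The small Davenport constant $\mathsf{d}(G)$ is the maximal length (number of terms counted with multiplicity) of a product-one-free sequence over $G$. *)

theory Defs
  imports "HOL-Analysis.Analysis" "HOL-Algebra.Coset" "HOL-Library.Multiset"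
begin

definition seq_over :: "('a, 'b) monoid_scheme \<Rightarrow> 'a multiset \<Rightarrow> bool" where
  "seq_over G S \<longleftrightarrow> set_mset S \<subseteq> carrier G - {\<one>\<^bsub>G\<^esub>}"

definition list_product :: "('a, 'b) monoid_scheme \<Rightarrow> 'a list \<Rightarrow> 'a" where
  "list_product G xs = foldr (\<lambda>x y. x \<otimes>\<^bsub>G\<^esub> y) xs \<one>\<^bsub>G\<^esub>"

definition product_one_free :: "('a, 'b) monoid_scheme \<Rightarrow> 'a multiset \<Rightarrow> bool" where
  "product_one_free G S \<longleftrightarrow>
     \<not> (\<exists>T xs. T \<subseteq># S \<and> T \<noteq> {#} \<and> mset xs = T \<and> list_product G xs = \<one>\<^bsub>G\<^esub>)"

text \<open>\<^const>\<open>Max\<close> is meaningful only on finite nonempty sets; see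
  \<open>finite_product_one_free_sizes\<close> below.\<close>

definition small_davenport :: "('a, 'b) monoid_scheme \<Rightarrow> nat" where
  "small_davenport G = Max {size S | S. seq_over G S \<and> product_one_free G S}"

lemma zero_in_product_one_free_sizes:
  "0 \<in> {size S | S. seq_over G S \<and> product_one_free G S}"
  by (rule CollectI, rule exI[of _ "{#}"]) (auto simp: seq_over_def product_one_free_def)

lemma (in monoid) list_product_closed:
  "set xs \<subseteq> carrier G \<Longrightarrow> list_product G xs \<in> carrier G"
  by (induction xs) (auto simp: list_product_def)

lemma (in monoid) list_product_append:
  "set xs \<subseteq> carrier G \<Longrightarrow> set ys \<subseteq> carrier G \<Longrightarrow>
   list_product G (xs @ ys) = list_product G xs \<otimes> list_product G ys"
proof (induction xs)
  case Nil
  then show ?case using list_product_closed[of ys] by (simp add: list_product_def)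
next
  case (Cons x xs)
  then show ?case
    using list_product_closed[of xs] list_product_closed[of ys]
    by (simp add: list_product_def m_assoc)
qed

lemma (in group) product_one_free_size_less_order:
  assumes fin: "finite (carrier G)" and S: "seq_over G S" "product_one_free G S"
  shows "size S < Coset.order G"
proof (rule ccontr)
  assume "\<not> size S < Coset.order G"
  hence big: "card (carrier G) \<le> size S" by (simp add: Coset.order_def)
  obtain xs where xs: "mset xs = S" using ex_mset by blast
  have len: "length xs = size S" using xs by auto
  have sub: "set xs \<subseteq> carrier G" using S(1) xs by (auto simp: seq_over_def)
  define p where "p i = list_product G (take i xs)" for i
  have "p ` {0..length xs} \<subseteq> carrier G"
    unfolding p_def using sub list_product_closed by (blast dest: in_set_takeD)
  hence "card (p ` {0..length xs}) \<le> card (carrier G)" by (rule card_mono[OF fin])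
  hence "card (p ` {0..length xs}) < card {0..length xs}" using big len by simp
  hence "\<not> inj_on p {0..length xs}" using pigeonhole by blast
  then obtain i j where ij: "i < j" "j \<le> length xs" "p i = p j"
    unfolding inj_on_def by (metis atLeastAtMost_iff linorder_neqE_nat)
  define ys where "ys = take (j - i) (drop i xs)"
  have ys: "set ys \<subseteq> carrier G" "set (take i xs) \<subseteq> carrier G"
    unfolding ys_def using sub by (blast dest: in_set_takeD in_set_dropD)+
  have "take j xs = take i xs @ ys"
    unfolding ys_def using ij(1) by (metis le_add_diff_inverse less_imp_le take_add)
  hence "p j = p i \<otimes> list_product G ys"
    unfolding p_def using list_product_append[OF ys(2,1)] by simp
  hence one: "list_product G ys = \<one>"
    using ij(3) l_cancel_one'[OF list_product_closed[OF ys(2)] list_product_closed[OF ys(1)]]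
    unfolding p_def by simp
  have "xs = take i xs @ ys @ drop (j - i) (drop i xs)"
    unfolding ys_def by (simp del: drop_drop)
  from arg_cong[OF this, of mset]
  have "mset xs = mset ys + (mset (take i xs) + mset (drop (j - i) (drop i xs)))"
    by (simp only: mset_append add.commute add.left_commute)
  hence "mset ys \<subseteq># S" using xs by (metis mset_subset_eq_add_left)
  moreover have "mset ys \<noteq> {#}" using ij unfolding ys_def by simp
  ultimately show False using S(2) one unfolding product_one_free_def by blast
qed

lemma (in group) finite_product_one_free_sizes:
  assumes "finite (carrier G)"
  shows "finite {size S | S. seq_over G S \<and> product_one_free G S}"
  by (rule finite_subset[of _ "{..<Coset.order G}"])
     (auto dest: product_one_free_size_less_order[OF assms])

text \<open>The numeral type \<^typ>\<open>7\<close> carries arithmetic modulo 7. The library only provides the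
  ring structure; that it is a field is shown here.\<close>

lemma F7_field:
  fixes x :: 7
  assumes "x \<noteq> 0"
  shows "\<exists>y. x * y = 1"
proof (cases x)
  case (of_int z)
  hence z: "z \<in> {0, 1, 2, 3, 4, 5, 6}" by auto
  have "(1::7) * 1 = 1" "(2::7) * 4 = 1" "(3::7) * 5 = 1" "(4::7) * 2 = 1"
    "(5::7) * 3 = 1" "(6::7) * 6 = 1" by simp_all
  moreover have "x \<in> {1, 2, 3, 4, 5, 6}" using z of_int assms by auto
  ultimately show ?thesis by blast
qed

definition heis_mat :: "7 \<Rightarrow> 7 \<Rightarrow> 7 \<Rightarrow> 7^3^3" where
  "heis_mat a b c = vector [vector [1, a, c],
                            vector [0, 1, b],
                            vector [0, 0, 1]]"

definition H343 :: "(7^3^3) monoid" where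
  "H343 = \<lparr>carrier = {heis_mat a b c | a b c. True}, mult = (**), one = mat 1\<rparr>"

lemma heis_mat_mult:
  "heis_mat a b c ** heis_mat a' b' c' = heis_mat (a + a') (b + b') (c + c' + a * b')"
  by (simp add: heis_mat_def matrix_matrix_mult_def vec_eq_iff forall_3 sum_3 algebra_simps)

lemma heis_mat_one: "mat 1 = heis_mat 0 0 0"
  by (simp add: heis_mat_def mat_def vec_eq_iff forall_3)

lemma heis_mat_eq_iff: "heis_mat a b c = heis_mat a' b' c' \<longleftrightarrow> a = a' \<and> b = b' \<and> c = c'"
  by (auto simp: heis_mat_def vec_eq_iff forall_3)

lemma group_H343: "group H343"
proof (rule groupI)
  fix x assume "x \<in> carrier H343"
  then obtain a b c where x: "x = heis_mat a b c" by (auto simp: H343_def)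
  have "heis_mat (- a) (- b) (a * b - c) ** x = mat 1"
    by (simp add: x heis_mat_mult heis_mat_one)
  thus "\<exists>y\<in>carrier H343. y \<otimes>\<^bsub>H343\<^esub> x = \<one>\<^bsub>H343\<^esub>"
    by (auto simp: H343_def)
next
  show "\<one>\<^bsub>H343\<^esub> \<in> carrier H343" by (auto simp: H343_def heis_mat_one)
next
  fix x y assume "x \<in> carrier H343" "y \<in> carrier H343"
  then obtain a b c a' b' c' where "x = heis_mat a b c" "y = heis_mat a' b' c'"
    by (auto simp: H343_def)
  hence "x \<otimes>\<^bsub>H343\<^esub> y = heis_mat (a + a') (b + b') (c + c' + a * b')"
    by (simp add: H343_def heis_mat_mult)
  thus "x \<otimes>\<^bsub>H343\<^esub> y \<in> carrier H343"
    unfolding H343_def by auto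
qed (auto simp: H343_def matrix_mul_assoc)

lemma order_H343: "Coset.order H343 = 343"
proof -
  have "carrier H343 = (\<lambda>(a, b, c). heis_mat a b c) ` UNIV"
    by (simp add: H343_def image_def set_eq_iff)
  moreover have "inj (\<lambda>(a, b, c). heis_mat a b c)"
    by (auto simp: inj_on_def heis_mat_eq_iff)
  ultimately have "card (carrier H343) = CARD(7 \<times> 7 \<times> 7)"
    by (simp add: card_image)
  thus ?thesis by (simp add: Coset.order_def)
qed

end

theory Submission
  imports Defs
begin

text \<open>The lower bound is attained by six copies each of \<open>x = heis_mat 1 0 0\<close>,
  \<open>y = heis_mat 0 1 0\<close> and \<open>z = heis_mat 0 0 1\<close>. In the abelianisation a product of terms
  records the numbers of \<open>x\<close>'s and \<open>y\<close>'s modulo 7; these numbers are at most 6, so a product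
  equal to the identity uses no \<open>x\<close> and no \<open>y\<close>, and then it is a power of \<open>z\<close> with exponent
  at most 6.

  For the upper bound, the augmentation ideal \<open>J\<close> of the group algebra of \<open>H343\<close> over the field
  with 7 elements satisfies \<open>J ^ 25 = 0\<close>, so a product of 25 factors \<open>g - 1\<close> vanishes. Expanding
  it gives an alternating sum over the subsequences of the \<open>g\<close>'s. The empty subsequence contributes
  the identity, and this term can only cancel against a nonempty subsequence with product one.

  The nilpotency is proved in dual form. The element \<open>g - 1\<close> acts on functions on the group as the
  difference operator \<open>f \<mapsto> (\<lambda>h. f (h g) - f h)\<close>. Regard functions as polynomials in the matrix
  entries \<open>a\<close>, \<open>b\<close>, \<open>c\<close>, where \<open>a\<close> and \<open>b\<close> have weight 1 and \<open>c\<close> has weight 2. Right translation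
  sends \<open>c\<close> to \<open>c + c' + a b'\<close>, whose new terms have weight at most 1, so every difference operator
  lowers the weighted degree (\<open>weighted_poly_diff\<close>). The indicator function of the identity is
  \<open>(1 - a^6) (1 - b^6) (1 - c^6)\<close>, of weighted degree \<open>6 + 6 + 12 = 24\<close>; hence 25 differences
  annihilate it, while along a product-one-free sequence its iterated difference at the identity
  is \<open>1\<close> or \<open>-1\<close> (\<open>iterated_diff_eq\<close>).\<close>

section \<open>Iterated differences on a monoid\<close>

primrec iterated_diff ::
  "('g, 'm) monoid_scheme \<Rightarrow> 'g list \<Rightarrow> ('g \<Rightarrow> 'a::ring_1) \<Rightarrow> 'g \<Rightarrow> 'a" where
  "iterated_diff G [] f = f"
| "iterated_diff G (g # gs) f =
     (\<lambda>h. iterated_diff G gs f (h \<otimes>\<^bsub>G\<^esub> g) - iterated_diff G gs f h)"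

text \<open>The iterated difference at \<open>h\<close> is the alternating sum of the values of \<open>f\<close> at \<open>h\<close> times the
  products of the subsequences of \<open>gs\<close>; under the hypothesis only the empty one contributes.\<close>

lemma (in monoid) iterated_diff_eq:
  assumes "set gs \<subseteq> carrier G" "h \<in> carrier G"
    and "\<And>xs. xs \<noteq> [] \<Longrightarrow> mset xs \<subseteq># mset gs \<Longrightarrow> f (h \<otimes> list_product G xs) = 0"
  shows "iterated_diff G gs f h = (- 1) ^ length gs * f h"
  using assms
proof (induction gs arbitrary: h)
  case Nil
  then show ?case by simp
next
  case (Cons g gs)
  have g: "g \<in> carrier G" and gs: "set gs \<subseteq> carrier G"
    using Cons.prems(1) by auto
  have step: "f ((h \<otimes> g) \<otimes> list_product G xs) = 0" if "mset xs \<subseteq># mset gs" for xs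
  proof -
    have "set xs \<subseteq> carrier G"
      using gs set_mset_mono[OF that] by auto
    then have "(h \<otimes> g) \<otimes> list_product G xs = h \<otimes> list_product G (g # xs)"
      using g Cons.prems(2) list_product_closed[of xs] by (simp add: list_product_def m_assoc)
    then show ?thesis
      using Cons.prems(3)[of "g # xs"] that by simp
  qed
  have "f (h \<otimes> g) = 0"
    using step[of "[]"] g Cons.prems(2) by (simp add: list_product_def)
  moreover have "iterated_diff G gs f (h \<otimes> g) = (- 1) ^ length gs * f (h \<otimes> g)"
    using step g gs Cons.prems(2) by (intro Cons.IH) auto
  moreover have "f (h \<otimes> list_product G xs) = 0" if "xs \<noteq> []" "mset xs \<subseteq># mset gs" for xs
  proof -
    have "mset xs \<subseteq># mset (g # gs)"
      using that(2) by (rule subset_mset.order_trans) simp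
    then show ?thesis
      using Cons.prems(3) that(1) by blast
  qed
  then have "iterated_diff G gs f h = (- 1) ^ length gs * f h"
    using gs Cons.prems(2) by (intro Cons.IH) auto
  ultimately show ?case
    by simp
qed

section \<open>Weighted degree\<close>

text \<open>The index strictly bounds the weighted degree, where \<open>a\<close> and \<open>b\<close> have weight 1 and \<open>c\<close> has
  weight 2. Because the bound is strict, level 0 is the zero space, so the statement that a
  difference lowers the level also covers the constants.\<close>

inductive weighted_poly :: "nat \<Rightarrow> ('a::comm_ring_1 \<Rightarrow> 'a \<Rightarrow> 'a \<Rightarrow> 'a) \<Rightarrow> bool" where
  zero: "weighted_poly n (\<lambda>a b c. 0)"
| const: "weighted_poly (Suc n) (\<lambda>a b c. r)"
| add: "weighted_poly n f \<Longrightarrow> weighted_poly n g \<Longrightarrow> weighted_poly n (\<lambda>a b c. f a b c + g a b c)"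
| mult_a: "weighted_poly n f \<Longrightarrow> weighted_poly (Suc n) (\<lambda>a b c. a * f a b c)"
| mult_b: "weighted_poly n f \<Longrightarrow> weighted_poly (Suc n) (\<lambda>a b c. b * f a b c)"
| mult_c: "weighted_poly n f \<Longrightarrow> weighted_poly (Suc (Suc n)) (\<lambda>a b c. c * f a b c)"

lemma weighted_poly_0:
  assumes "weighted_poly 0 f"
  shows "f = (\<lambda>a b c. 0)"
  using assms by (induction "0::nat" f rule: weighted_poly.induct) auto

lemma weighted_poly_Suc: "weighted_poly n f \<Longrightarrow> weighted_poly (Suc n) f"
  by (induction rule: weighted_poly.induct) (auto intro: weighted_poly.intros)

lemma weighted_poly_mono:
  assumes "weighted_poly m f" "m \<le> n"
  shows "weighted_poly n f"
  using assms(2,1) by (induction rule: dec_induct) (auto intro: weighted_poly_Suc)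

lemma weighted_poly_scale: "weighted_poly n f \<Longrightarrow> weighted_poly n (\<lambda>a b c. r * f a b c)"
proof (induction rule: weighted_poly.induct)
  case (zero n)
  show ?case by (simp add: weighted_poly.zero)
next
  case (const n s)
  show ?case by (rule weighted_poly.const)
next
  case (add n f g)
  show ?case using weighted_poly.add[OF add.IH] by (simp add: distrib_left)
next
  case (mult_a n f)
  show ?case using weighted_poly.mult_a[OF mult_a.IH] by (simp only: mult.left_commute[of r])
next
  case (mult_b n f)
  show ?case using weighted_poly.mult_b[OF mult_b.IH] by (simp only: mult.left_commute[of r])
next
  case (mult_c n f)
  show ?case using weighted_poly.mult_c[OF mult_c.IH] by (simp only: mult.left_commute[of r])
qed

lemma weighted_poly_of_diff:
  assumes "weighted_poly n f"
    and "weighted_poly (n - 1) (\<lambda>a b c. g a b c - f a b c)"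
  shows "weighted_poly n g"
proof -
  have "weighted_poly n (\<lambda>a b c. g a b c - f a b c)"
    using weighted_poly_mono[OF assms(2)] by simp
  from weighted_poly.add[OF assms(1) this] show ?thesis by simp
qed

text \<open>The case of a product follows from the Leibniz rule
  \<open>\<Delta> (u f) = u \<Delta> f + \<Delta> u (f + \<Delta> f)\<close> applied to \<open>u = a, b, c\<close>, because
  \<open>\<Delta> a = a'\<close>, \<open>\<Delta> b = b'\<close> and \<open>\<Delta> c = c' + a b'\<close> have smaller weight than \<open>u\<close>.\<close>

lemma weighted_poly_diff:
  fixes f :: "'a::comm_ring_1 \<Rightarrow> 'a \<Rightarrow> 'a \<Rightarrow> 'a"
  assumes "weighted_poly n f"
  shows "weighted_poly (n - 1)
    (\<lambda>a b c. f (a + a') (b + b') (c + c' + a * b') - f a b c)"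
  using assms
proof (induction rule: weighted_poly.induct)
  case (zero n)
  show ?case by (simp add: weighted_poly.zero)
next
  case (const n r)
  show ?case by (simp add: weighted_poly.zero)
next
  case (add n f g)
  show ?case using weighted_poly.add[OF add.IH] by (simp add: algebra_simps)
next
  case (mult_a n f)
  let ?s = "\<lambda>a b c. f (a + a') (b + b') (c + c' + a * b')"
  let ?d = "\<lambda>a b c. ?s a b c - f a b c"
  have s: "weighted_poly n ?s"
    using weighted_poly_of_diff[OF mult_a] .
  \<comment> \<open>For \<open>n = 0\<close> the truncated index \<open>n - 1\<close> loses nothing, but the factor \<open>a\<close> would raise the
    level to 1; there \<open>f\<close> itself is zero.\<close>
  have "weighted_poly n (\<lambda>a b c. a * ?d a b c)"
    using weighted_poly.mult_a[OF mult_a.IH] weighted_poly_0[of f] mult_a.hyps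
    by (cases n) (auto intro: weighted_poly.zero)
  from weighted_poly.add[OF this weighted_poly_scale[OF s, of a']]
  show ?case by (simp add: algebra_simps)
next
  case (mult_b n f)
  let ?s = "\<lambda>a b c. f (a + a') (b + b') (c + c' + a * b')"
  let ?d = "\<lambda>a b c. ?s a b c - f a b c"
  have s: "weighted_poly n ?s"
    using weighted_poly_of_diff[OF mult_b] .
  have "weighted_poly n (\<lambda>a b c. b * ?d a b c)"
    using weighted_poly.mult_b[OF mult_b.IH] weighted_poly_0[of f] mult_b.hyps
    by (cases n) (auto intro: weighted_poly.zero)
  from weighted_poly.add[OF this weighted_poly_scale[OF s, of b']]
  show ?case by (simp add: algebra_simps)
next
  case (mult_c n f)
  let ?s = "\<lambda>a b c. f (a + a') (b + b') (c + c' + a * b')"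
  let ?d = "\<lambda>a b c. ?s a b c - f a b c"
  have s: "weighted_poly n ?s"
    using weighted_poly_of_diff[OF mult_c] .
  have "weighted_poly (Suc n) (\<lambda>a b c. c * ?d a b c)"
    using weighted_poly.mult_c[OF mult_c.IH] weighted_poly_0[of f] mult_c.hyps
    by (cases n) (auto intro: weighted_poly.zero)
  moreover have "weighted_poly (Suc n) (\<lambda>a b c. c' * ?s a b c)"
    using weighted_poly_Suc[OF weighted_poly_scale[OF s]] .
  moreover have "weighted_poly (Suc n) (\<lambda>a b c. b' * (a * ?s a b c))"
    using weighted_poly_scale[OF weighted_poly.mult_a[OF s]] .
  ultimately have "weighted_poly (Suc n)
    (\<lambda>a b c. c * ?d a b c + c' * ?s a b c + b' * (a * ?s a b c))"
    by (intro weighted_poly.add)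
  then show ?case by (simp add: algebra_simps)
qed

lemma weighted_poly_power_mult:
  assumes "weighted_poly n f"
  shows "weighted_poly (k + n) (\<lambda>a b c. a ^ k * f a b c)"
    and "weighted_poly (k + n) (\<lambda>a b c. b ^ k * f a b c)"
    and "weighted_poly (2 * k + n) (\<lambda>a b c. c ^ k * f a b c)"
proof -
  show "weighted_poly (k + n) (\<lambda>a b c. a ^ k * f a b c)"
    using assms by (induction k) (auto dest: weighted_poly.mult_a simp: mult.assoc)
  show "weighted_poly (k + n) (\<lambda>a b c. b ^ k * f a b c)"
    using assms by (induction k) (auto dest: weighted_poly.mult_b simp: mult.assoc)
  show "weighted_poly (2 * k + n) (\<lambda>a b c. c ^ k * f a b c)"
    using assms by (induction k) (auto dest: weighted_poly.mult_c simp: mult.assoc)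
qed

lemma weighted_poly_minus:
  assumes "weighted_poly n f" "weighted_poly n g"
  shows "weighted_poly n (\<lambda>a b c. f a b c - g a b c)"
  using weighted_poly.add[OF assms(1) weighted_poly_scale[OF assms(2), of "- 1"]] by simp

section \<open>The indicator function of the identity\<close>

lemma F7_power6: "(x::7) ^ 6 = of_bool (x \<noteq> 0)"
proof (cases x)
  case (of_int z)
  then have "z \<in> {0, 1, 2, 3, 4, 5, 6}" by auto
  then show ?thesis using of_int by auto
qed

lemma weighted_poly_indicator_one:
  "weighted_poly 25 (\<lambda>a b c. of_bool (heis_mat a b c = mat 1))"
proof -
  have one: "weighted_poly n (\<lambda>a b c. 1::7)" if "1 \<le> n" for n
    using weighted_poly_mono[OF weighted_poly.const that[unfolded One_nat_def]] .
  have c: "weighted_poly 13 (\<lambda>a b c. 1 - c ^ 6 * (1::7))"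
    using weighted_poly_power_mult(3)[OF one[of 1], of 6]
    by (intro weighted_poly_minus one) simp_all
  have b: "weighted_poly 19 (\<lambda>a b c. (1 - c ^ 6 * (1::7)) - b ^ 6 * (1 - c ^ 6 * 1))"
    using weighted_poly_power_mult(2)[OF c, of 6]
    by (intro weighted_poly_minus weighted_poly_mono[OF c]) simp_all
  have "weighted_poly 25 (\<lambda>a b c. ((1 - c ^ 6 * (1::7)) - b ^ 6 * (1 - c ^ 6 * 1))
      - a ^ 6 * ((1 - c ^ 6 * 1) - b ^ 6 * (1 - c ^ 6 * 1)))"
    using weighted_poly_power_mult(1)[OF b, of 6]
    by (intro weighted_poly_minus weighted_poly_mono[OF b]) simp_all
  also have "(\<lambda>a b c. ((1 - c ^ 6 * (1::7)) - b ^ 6 * (1 - c ^ 6 * 1))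
      - a ^ 6 * ((1 - c ^ 6 * 1) - b ^ 6 * (1 - c ^ 6 * 1)))
    = (\<lambda>a b c. of_bool (heis_mat a b c = mat 1))"
    by (intro ext) (simp add: heis_mat_one heis_mat_eq_iff F7_power6)
  finally show ?thesis .
qed

section \<open>The two bounds\<close>

lemma weighted_poly_iterated_diff:
  assumes "set gs \<subseteq> carrier H343" "weighted_poly n (\<lambda>a b c. f (heis_mat a b c))"
  shows "weighted_poly (n - length gs) (\<lambda>a b c. iterated_diff H343 gs f (heis_mat a b c))"
  using assms(1)
proof (induction gs)
  case Nil
  then show ?case using assms(2) by simp
next
  case (Cons g gs)
  then obtain a' b' c' where g: "g = heis_mat a' b' c'"
    by (auto simp: H343_def)
  have "weighted_poly (n - length gs) (\<lambda>a b c. iterated_diff H343 gs f (heis_mat a b c))"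
    using Cons by simp
  from weighted_poly_diff[OF this, of a' b' c']
  show ?case by (simp add: g H343_def heis_mat_mult)
qed

lemma product_one_free_size_le:
  assumes "seq_over H343 S" "product_one_free H343 S"
  shows "size S \<le> 24"
proof (rule ccontr)
  interpret group H343 by (rule group_H343)
  assume "\<not> size S \<le> 24"
  obtain xs where xs: "mset xs = S" using ex_mset by blast
  have len: "25 \<le> length xs"
    using \<open>\<not> size S \<le> 24\<close> xs by auto
  have car: "set xs \<subseteq> carrier H343"
    using assms(1) xs by (auto simp: seq_over_def)
  define f :: "7^3^3 \<Rightarrow> 7" where "f h = of_bool (h = mat 1)" for h
  have "weighted_poly 0 (\<lambda>a b c. iterated_diff H343 xs f (heis_mat a b c))"
    using weighted_poly_iterated_diff[OF car, of 25 f] weighted_poly_indicator_one len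
    by (simp add: f_def)
  from fun_cong[OF fun_cong[OF fun_cong[OF weighted_poly_0[OF this]]], of 0 0 0]
  have "iterated_diff H343 xs f (heis_mat 0 0 0) = 0" .
  moreover have "iterated_diff H343 xs f \<one>\<^bsub>H343\<^esub> = (- 1) ^ length xs * f \<one>\<^bsub>H343\<^esub>"
  proof (rule iterated_diff_eq[OF car one_closed])
    fix ys assume ys: "ys \<noteq> []" "mset ys \<subseteq># mset xs"
    then have "list_product H343 ys \<noteq> \<one>\<^bsub>H343\<^esub>"
      using assms(2) xs unfolding product_one_free_def by auto
    moreover have "list_product H343 ys \<in> carrier H343"
      using car set_mset_mono[OF ys(2)] by (intro list_product_closed) auto
    ultimately show "f (\<one>\<^bsub>H343\<^esub> \<otimes>\<^bsub>H343\<^esub> list_product H343 ys) = 0"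
      by (simp add: f_def) (simp add: H343_def)
  qed
  ultimately show False
    by (simp add: f_def H343_def heis_mat_one minus_one_power_iff split: if_splits)
qed

text \<open>The twist \<open>a b'\<close> in the corner entry of a product is nonzero only if \<open>heis_mat 1 0 0\<close> occurs
  among the factors. Without it the corner entry just counts the factors \<open>heis_mat 0 0 1\<close>, and no
  formula for the corner entry is needed in the other case.\<close>

lemma list_product_generators:
  assumes "set xs \<subseteq> {heis_mat 1 0 0, heis_mat 0 1 0, heis_mat 0 0 1}"
  shows "\<exists>c. list_product H343 xs =
      heis_mat (of_nat (count (mset xs) (heis_mat 1 0 0)))
        (of_nat (count (mset xs) (heis_mat 0 1 0))) c \<and>
    (heis_mat 1 0 0 \<notin> set xs \<longrightarrow> c = of_nat (count (mset xs) (heis_mat 0 0 1)))"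
  using assms
proof (induction xs)
  case Nil
  then show ?case by (auto simp: list_product_def H343_def heis_mat_one)
next
  case (Cons x xs)
  then obtain c where c: "list_product H343 xs =
      heis_mat (of_nat (count (mset xs) (heis_mat 1 0 0)))
        (of_nat (count (mset xs) (heis_mat 0 1 0))) c"
    "heis_mat 1 0 0 \<notin> set xs \<longrightarrow> c = of_nat (count (mset xs) (heis_mat 0 0 1))"
    by auto
  have "list_product H343 (x # xs) = x ** list_product H343 xs"
    by (simp add: list_product_def H343_def)
  then show ?case
    using c Cons.prems by (auto simp: heis_mat_mult heis_mat_eq_iff)
qed

lemma of_nat_F7_eq_0:
  assumes "of_nat n = (0::7)" "n \<le> 6"
  shows "n = 0"
proof -
  have "n \<in> {0, 1, 2, 3, 4, 5, 6}" using assms(2) by auto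
  then show ?thesis using assms(1) by auto
qed

lemma product_one_free_generators:
  "product_one_free H343 (replicate_mset 6 (heis_mat 1 0 0) +
     replicate_mset 6 (heis_mat 0 1 0) + replicate_mset 6 (heis_mat 0 0 1))"
  (is "product_one_free _ ?S")
  unfolding product_one_free_def
proof clarify
  fix xs assume sub: "mset xs \<subseteq># ?S" and ne: "mset xs \<noteq> {#}"
    and one: "list_product H343 xs = \<one>\<^bsub>H343\<^esub>"
  have set: "set xs \<subseteq> {heis_mat 1 0 0, heis_mat 0 1 0, heis_mat 0 0 1}"
    using set_mset_mono[OF sub] by auto
  have le: "count (mset xs) x \<le> count ?S x" for x
    using sub by (rule mset_subset_eq_count)
  have x: "count (mset xs) (heis_mat 1 0 0) \<le> 6"
    and y: "count (mset xs) (heis_mat 0 1 0) \<le> 6"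
    and z: "count (mset xs) (heis_mat 0 0 1) \<le> 6"
    using le[of "heis_mat 1 0 0"] le[of "heis_mat 0 1 0"] le[of "heis_mat 0 0 1"]
    by (simp_all add: heis_mat_eq_iff)
  obtain c where c: "list_product H343 xs =
      heis_mat (of_nat (count (mset xs) (heis_mat 1 0 0)))
        (of_nat (count (mset xs) (heis_mat 0 1 0))) c"
    "heis_mat 1 0 0 \<notin> set xs \<longrightarrow> c = of_nat (count (mset xs) (heis_mat 0 0 1))"
    using list_product_generators[OF set] by blast
  have "heis_mat 0 0 0 = heis_mat (of_nat (count (mset xs) (heis_mat 1 0 0)))
      (of_nat (count (mset xs) (heis_mat 0 1 0))) c"
    using one c(1) by (simp add: H343_def heis_mat_one)
  then have eq: "of_nat (count (mset xs) (heis_mat 1 0 0)) = (0::7)"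
    "of_nat (count (mset xs) (heis_mat 0 1 0)) = (0::7)" "c = 0"
    by (simp_all add: heis_mat_eq_iff)
  have "count (mset xs) (heis_mat 1 0 0) = 0"
    using of_nat_F7_eq_0 eq(1) x by blast
  then have nx: "heis_mat 1 0 0 \<notin> set xs"
    by (simp add: count_eq_zero_iff)
  have "count (mset xs) (heis_mat 0 1 0) = 0"
    using of_nat_F7_eq_0 eq(2) y by blast
  then have ny: "heis_mat 0 1 0 \<notin> set xs"
    by (simp add: count_eq_zero_iff)
  have "of_nat (count (mset xs) (heis_mat 0 0 1)) = (0::7)"
    using c(2) nx eq(3) by simp
  then have "count (mset xs) (heis_mat 0 0 1) = 0"
    using of_nat_F7_eq_0 z by blast
  then have "heis_mat 0 0 1 \<notin> set xs"
    by (simp add: count_eq_zero_iff)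
  with nx ny set have "set xs = {}" by (simp add: subset_insert)
  then show False using ne by simp
qed

theorem mainTheorem3:
  shows "18 \<le> small_davenport H343 \<and> small_davenport H343 \<le> 24"
proof -
  interpret group H343 by (rule group_H343)
  let ?sizes = "{size S | S. seq_over H343 S \<and> product_one_free H343 S}"
  let ?S = "replicate_mset 6 (heis_mat 1 0 0) +
     replicate_mset 6 (heis_mat 0 1 0) + replicate_mset 6 (heis_mat 0 0 1)"
  have "finite (carrier H343)"
    by (rule card_ge_0_finite) (use order_H343 in \<open>simp add: Coset.order_def\<close>)
  then have fin: "finite ?sizes"
    by (rule finite_product_one_free_sizes)
  have "seq_over H343 ?S"
    by (auto simp: seq_over_def H343_def heis_mat_one heis_mat_eq_iff)
  moreover have "size ?S = 18" by simp
  ultimately have "18 \<in> ?sizes"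
    using product_one_free_generators by (metis (mono_tags, lifting) mem_Collect_eq)
  then have "18 \<le> Max ?sizes"
    using fin by (intro Max_ge)
  moreover have "Max ?sizes \<le> 24"
    using fin zero_in_product_one_free_sizes[of H343] product_one_free_size_le
    by (subst Max_le_iff) auto
  ultimately show ?thesis
    by (simp add: small_davenport_def)
qed

end
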